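(* Let $X$ and $Y$ be compact convex sets and let $\varphi\colon X\to Y$ be a continuous affine surjection such that $\varphi^*(\mathfrak{A}(Y))$ is a complemented subspace of $\mathfrak{A}(X)$. Let $F$ be a topological vector space. Let $f\colon Y\to F$ be a mapping such that $f\circ\varphi\in\mathfrak{A}_\alpha(X,F)$ for some $\alpha<\omega_1$. Then $f\in\mathfrak{A}_\alpha(Y,F)$.
   Context: A compact convex set is a compact convex subset of a (Hausdorff) locally convex space. For a compact convex set $X$, $\mathfrak{A}(X)$ denotes the Banach space of all real-valued continuous affine functions on $X$ with the supremum norm. For a continuous affine surjection $\varphi\colon X\to Y$, the isometric embedding $\varphi^*\colon\mathfrak{A}(Y)\to\mathfrak{A}(X)$ is defined by $\varphi^*(g)=g\circ\varphi$. A subspace of a Banach space is complemented if it is the range of a bounded linear projection. For a topological vector space $F$, $\mathfrak{A}(X,F)$ is the set of all continuous affine maps from $X$ to $F$. The affine Baire classes are defined by transfinite recursion: $\mathfrak{A}_0(X,F)=\mathfrak{A}(X,F)$, and for $1\le\alpha<\omega_1$, $\mathfrak{A}_\alpha(X,F)$ is the set of all maps $f\colon X\to F$ for which there is a sequence $(f_n)$ in $\bigcup_{\beta<\alpha}\mathfrak{A}_\beta(X,F)$ converging to $f$ pointwise on $X$. No local convexity, metrizability or completeness of $F$ is assumed. *)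

theory Defs
  imports "HOL-Analysis.Analysis" "HOL-Library.FuncSet"
begin

section \<open>Topological vector spaces\<close>

text \<open>Real topological vector spaces, not assumed to be Hausdorff. A complex topological vector
  space is one by restriction of scalars, and affine maps only involve real scalars.\<close>

class topological_real_vector = topological_ab_group_add + real_vector +
  assumes tendsto_scaleR_Pair:
    "LIM z (nhds r \<times>\<^sub>F nhds x). fst z *\<^sub>R snd z :> nhds (r *\<^sub>R x)"

text \<open>The class language does not admit \<^const>\<open>convex\<close> here, so its definition is written out;
  see \<open>convex_open_neighbourhood_0\<close>.\<close>

class hausdorff_locally_convex = topological_real_vector + t2_space +
  assumes convex_neighbourhood_0:
    "open U \<Longrightarrow> 0 \<in> U \<Longrightarrow> \<exists>V. open V \<and>
      (\<forall>x\<in>V. \<forall>y\<in>V. \<forall>u\<ge>0. \<forall>v\<ge>0. u + v = 1 \<longrightarrow> u *\<^sub>R x + v *\<^sub>R y \<in> V) \<and> 0 \<in> V \<and> V \<subseteq> U"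

lemma convex_open_neighbourhood_0:
  fixes U :: "'a::hausdorff_locally_convex set"
  assumes "open U" "0 \<in> U"
  shows "\<exists>V. open V \<and> convex V \<and> 0 \<in> V \<and> V \<subseteq> U"
  using convex_neighbourhood_0[OF assms] unfolding convex_def .

instance real_normed_vector \<subseteq> topological_real_vector
proof
  fix r :: real and x :: 'a
  show "LIM z (nhds r \<times>\<^sub>F nhds x). fst z *\<^sub>R snd z :> nhds (r *\<^sub>R x)"
    by (intro tendsto_scaleR filterlim_fst filterlim_snd)
qed

instance real_normed_vector \<subseteq> hausdorff_locally_convex
proof
  fix U :: "'a set"
  assume "open U" "0 \<in> U"
  then obtain e where "e > 0" "ball 0 e \<subseteq> U"
    by (meson open_contains_ball)
  then have "\<exists>V. open V \<and> convex V \<and> 0 \<in> V \<and> V \<subseteq> U"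
    by (intro exI[of _ "ball 0 e"]) auto
  then show "\<exists>V. open V \<and>
      (\<forall>x\<in>V. \<forall>y\<in>V. \<forall>u\<ge>0. \<forall>v\<ge>0. u + v = 1 \<longrightarrow> u *\<^sub>R x + v *\<^sub>R y \<in> V) \<and> 0 \<in> V \<and> V \<subseteq> U"
    unfolding convex_def .
qed


section \<open>Spaces of continuous affine maps\<close>

text \<open>A map with domain \<open>X\<close> is represented by a function in \<^term>\<open>extensional X\<close>, so that
  equality of functions is equality on \<open>X\<close>.\<close>

definition affine_on :: "'a::real_vector set \<Rightarrow> ('a \<Rightarrow> 'b::real_vector) \<Rightarrow> bool" where
  "affine_on X f \<longleftrightarrow> (\<forall>x\<in>X. \<forall>y\<in>X. \<forall>t\<in>{0..1}.
     f ((1 - t) *\<^sub>R x + t *\<^sub>R y) = (1 - t) *\<^sub>R f x + t *\<^sub>R f y)"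

definition cont_affine ::
  "'a::{topological_space, real_vector} set \<Rightarrow> ('a \<Rightarrow> 'b::topological_real_vector) set" where
  "cont_affine X = {f \<in> extensional X. continuous_on X f \<and> affine_on X f}"

text \<open>The inserted \<open>0\<close> only matters when \<open>X\<close> is empty.\<close>

definition sup_norm :: "'a set \<Rightarrow> ('a \<Rightarrow> real) \<Rightarrow> real" where
  "sup_norm X f = Sup (insert 0 ((\<lambda>x. \<bar>f x\<bar>) ` X))"

text \<open>Here \<open>V\<close> is a vector space of bounded real functions on \<open>X\<close>, with pointwise operations and
  the supremum norm.\<close>

definition bounded_linear_projection ::
  "'a set \<Rightarrow> ('a \<Rightarrow> real) set \<Rightarrow> (('a \<Rightarrow> real) \<Rightarrow> ('a \<Rightarrow> real)) \<Rightarrow> bool" where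
  "bounded_linear_projection X V P \<longleftrightarrow>
     P \<in> V \<rightarrow> V \<and>
     (\<forall>f\<in>V. \<forall>g\<in>V. P (\<lambda>x\<in>X. f x + g x) = (\<lambda>x\<in>X. P f x + P g x)) \<and>
     (\<forall>c. \<forall>f\<in>V. P (\<lambda>x\<in>X. c * f x) = (\<lambda>x\<in>X. c * P f x)) \<and>
     (\<exists>K. \<forall>f\<in>V. sup_norm X (P f) \<le> K * sup_norm X f) \<and>
     (\<forall>f\<in>V. P (P f) = P f)"

definition complemented_in ::
  "'a set \<Rightarrow> ('a \<Rightarrow> real) set \<Rightarrow> ('a \<Rightarrow> real) set \<Rightarrow> bool" where
  "complemented_in X V W \<longleftrightarrow> (\<exists>P. bounded_linear_projection X V P \<and> P ` V = W)"

definition pullback :: "'a set \<Rightarrow> ('a \<Rightarrow> 'b) \<Rightarrow> ('b \<Rightarrow> 'c) \<Rightarrow> ('a \<Rightarrow> 'c)" where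
  "pullback X \<phi> g = compose X g \<phi>"


section \<open>Countable ordinals\<close>

text \<open>The cardinal successor of the order type of the natural numbers is the initial ordinal
  \<open>\<omega>\<^sub>1\<close>; the elements of its field are the ordinals below \<open>\<omega>\<^sub>1\<close>.\<close>

typedef omega1 = "Field (cardSuc natLeq)"
proof -
  have "Field (cardSuc natLeq) \<noteq> {}"
    using cardSuc_finite[OF natLeq_Card_order] by (auto simp: Field_natLeq)
  then show ?thesis by blast
qed

lemma cardSuc_natLeq_Well_order: "Well_order (cardSuc natLeq)"
  using cardSuc_Card_order[OF natLeq_Card_order] by (simp add: card_order_on_well_order_on)

instantiation omega1 :: wellorder
begin

definition less_eq_omega1 :: "omega1 \<Rightarrow> omega1 \<Rightarrow> bool" where
  "\<alpha> \<le> \<beta> \<longleftrightarrow> (Rep_omega1 \<alpha>, Rep_omega1 \<beta>) \<in> cardSuc natLeq"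

definition less_omega1 :: "omega1 \<Rightarrow> omega1 \<Rightarrow> bool" where
  "\<alpha> < (\<beta>::omega1) \<longleftrightarrow> \<alpha> \<le> \<beta> \<and> \<alpha> \<noteq> \<beta>"

instance
proof
  note wo = cardSuc_natLeq_Well_order[unfolded order_on_defs]
  fix \<alpha> \<beta> \<gamma> :: omega1
  have anti: "\<alpha> = \<beta>" if "\<alpha> \<le> \<beta>" "\<beta> \<le> \<alpha>" for \<alpha> \<beta> :: omega1
    using that wo unfolding less_eq_omega1_def antisym_def by (metis Rep_omega1_inject)
  show "\<alpha> < \<beta> \<longleftrightarrow> \<alpha> \<le> \<beta> \<and> \<not> \<beta> \<le> \<alpha>"
    using anti wo Rep_omega1[of \<alpha>]
    unfolding less_omega1_def less_eq_omega1_def refl_on_def by blast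
  show "\<alpha> \<le> \<alpha>"
    using wo Rep_omega1[of \<alpha>] unfolding less_eq_omega1_def refl_on_def by blast
  show "\<alpha> \<le> \<gamma>" if "\<alpha> \<le> \<beta>" "\<beta> \<le> \<gamma>"
    using that wo unfolding less_eq_omega1_def trans_def by blast
  show "\<alpha> = \<beta>" if "\<alpha> \<le> \<beta>" "\<beta> \<le> \<alpha>"
    using anti that .
  show "\<alpha> \<le> \<beta> \<or> \<beta> \<le> \<alpha>"
    using wo Rep_omega1[of \<alpha>] Rep_omega1[of \<beta>]
    unfolding less_eq_omega1_def total_on_def refl_on_def by metis
  show "P \<alpha>" if step: "\<And>\<alpha>. (\<And>\<beta>. \<beta> < \<alpha> \<Longrightarrow> P \<beta>) \<Longrightarrow> P \<alpha>" for P
  proof -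
    have "wf (inv_image (cardSuc natLeq - Id) Rep_omega1)"
      using wo by blast
    then show ?thesis
    proof (induction \<alpha> rule: wf_induct_rule)
      case (less \<alpha>)
      show ?case
        by (rule step, rule less)
          (auto simp: less_omega1_def less_eq_omega1_def Rep_omega1_inject)
    qed
  qed
qed

end

instantiation omega1 :: zero
begin

definition zero_omega1 :: omega1 where
  "0 = (LEAST \<alpha>::omega1. True)"

instance ..

end

lemma zero_le_omega1: "(0::omega1) \<le> \<alpha>"
  unfolding zero_omega1_def by (rule Least_le) simp

lemma countable_lessThan_omega1:
  includes cardinal_syntax
  shows "countable {..<\<alpha>::omega1}"
proof -
  let ?r = "cardSuc natLeq"
  have "|underS ?r (Rep_omega1 \<alpha>)| <o ?r"
    by (rule card_of_underS[OF cardSuc_Card_order[OF natLeq_Card_order] Rep_omega1])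
  then have "|underS ?r (Rep_omega1 \<alpha>)| \<le>o natLeq"
    by (simp add: cardSuc_ordLess_ordLeq[OF card_of_Card_order natLeq_Card_order]
        cardSuc_ordLeq_ordLess[OF natLeq_Card_order card_of_Card_order])
  then have "|underS ?r (Rep_omega1 \<alpha>)| \<le>o |UNIV :: nat set|"
    using card_of_nat ordIso_symmetric ordLeq_ordIso_trans by blast
  then have "countable (underS ?r (Rep_omega1 \<alpha>))"
    unfolding countable_def card_of_ordLeq[symmetric] by blast
  moreover have "Rep_omega1 ` {..<\<alpha>} \<subseteq> underS ?r (Rep_omega1 \<alpha>)"
    by (auto simp: underS_def less_omega1_def less_eq_omega1_def Rep_omega1_inject)
  ultimately have "countable (Rep_omega1 ` {..<\<alpha>})"
    by (rule countable_subset[rotated])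
  then show ?thesis
    by (rule countable_image_inj_on) (auto simp: inj_on_def Rep_omega1_inject)
qed

lemma uncountable_omega1:
  includes cardinal_syntax
  shows "uncountable (UNIV :: omega1 set)"
proof
  let ?r = "cardSuc natLeq"
  assume "countable (UNIV :: omega1 set)"
  then have "countable (range Rep_omega1)" by (rule countable_image)
  then have "countable (Field ?r)"
    using type_definition.Rep_range[OF type_definition_omega1] by metis
  then have "|Field ?r| \<le>o |UNIV :: nat set|"
    unfolding countable_def card_of_ordLeq[symmetric] by blast
  then have "?r \<le>o natLeq"
    using card_of_Field_ordIso[OF cardSuc_Card_order[OF natLeq_Card_order]] card_of_nat
    by (meson ordIso_ordLeq_trans ordIso_symmetric ordLeq_ordIso_trans)
  then show False
    using cardSuc_greater[OF natLeq_Card_order] not_ordLeq_ordLess by blast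
qed


section \<open>Affine Baire classes\<close>

function affine_baire ::
  "omega1 \<Rightarrow> 'a::{topological_space, real_vector} set \<Rightarrow> ('a \<Rightarrow> 'b::topological_real_vector) set"
where
  "affine_baire \<alpha> X =
     (if \<alpha> = 0 then cont_affine X
      else {f \<in> extensional X. \<exists>g :: nat \<Rightarrow> 'a \<Rightarrow> 'b.
              (\<forall>n. g n \<in> (\<Union>\<beta>\<in>{..<\<alpha>}. affine_baire \<beta> X)) \<and>
              (\<forall>x\<in>X. (\<lambda>n. g n x) \<longlonglongrightarrow> f x)})"
  by auto
termination
  by (relation "inv_image {(\<beta>, \<alpha>). \<beta> < \<alpha>} fst") (auto intro: wf)

declare affine_baire.simps [simp del]

end

theory Submission
  imports Defs
begin

text \<open>Let \<open>T\<close> be the bounded left inverse of \<open>\<phi>\<^sup>*\<close> given by the projection. For \<open>y \<in> Y\<close> the functional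
  \<open>g \<mapsto> T g y\<close> on the continuous affine functions of \<open>X\<close> is a difference \<open>a \<delta>\<^sub>x - b \<delta>\<^sub>z\<close> of point
  evaluations with \<open>a, b\<close> bounded independently of \<open>y\<close>, so a map \<open>f\<close> on \<open>X\<close> lifts to the map
  \<open>y \<mapsto> a f(x) - b f(z)\<close> on \<open>Y\<close>. This only uses the vector space operations of the range and therefore
  needs no local convexity. For continuous affine \<open>f\<close> the lift does not depend on the chosen
  representation, and compactness of the set of quadruples \<open>(a, x, b, z)\<close> makes it continuous.
  Lifting commutes with pointwise limits, hence preserves the Baire classes, and it sends
  \<open>f \<circ> \<phi>\<close> back to \<open>f\<close>, up to \<open>closure {0}\<close> if the range is not Hausdorff.\<close>

section \<open>Scalar multiplication in topological vector spaces\<close>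

lemma tendsto_scaleR_topological:
  fixes g :: "'i \<Rightarrow> 'a::topological_real_vector"
  assumes "(f \<longlongrightarrow> r) F" "(g \<longlongrightarrow> x) F"
  shows "((\<lambda>i. f i *\<^sub>R g i) \<longlongrightarrow> r *\<^sub>R x) F"
  using filterlim_compose[OF tendsto_scaleR_Pair, of "\<lambda>i. (f i, g i)" r x F] assms
  by (simp add: filterlim_Pair)

lemma continuous_on_scaleR_topological:
  fixes g :: "'i::topological_space \<Rightarrow> 'a::topological_real_vector"
  assumes "continuous_on S f" "continuous_on S g"
  shows "continuous_on S (\<lambda>i. f i *\<^sub>R g i)"
  using assms unfolding continuous_on_def by (blast intro: tendsto_scaleR_topological)

section \<open>Continuous linear functionals separate points\<close>

definition sublinear :: "('a::real_vector \<Rightarrow> real) \<Rightarrow> bool" where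
  "sublinear p \<longleftrightarrow> (\<forall>x y. p (x + y) \<le> p x + p y) \<and> (\<forall>c\<ge>0. \<forall>x. p (c *\<^sub>R x) \<le> c * p x)"

lemma sublinearD:
  assumes "sublinear p"
  shows "p (x + y) \<le> p x + p y" and "c \<ge> 0 \<Longrightarrow> p (c *\<^sub>R x) \<le> c * p x"
  using assms by (auto simp: sublinear_def)

text \<open>Applying the inequality to the factor \<open>1 / c\<close> as well reverses it. This is
  why the definition asks for homogeneity only as an inequality, which is easier to check for
  infima.\<close>

lemma sublinear_scaleR:
  assumes "sublinear p" "c \<ge> 0"
  shows "p (c *\<^sub>R x) = c * p x"
proof (cases "c = 0")
  case True
  have "p 0 \<le> p 0 + p 0" using sublinearD(1)[OF assms(1), of 0 0] by simp
  moreover have "p 0 \<le> 0" using sublinearD(2)[OF assms(1), of 0 0] by simp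
  ultimately show ?thesis using True by simp
next
  case False
  then have "c > 0" using assms(2) by simp
  have "p ((1 / c) *\<^sub>R (c *\<^sub>R x)) \<le> (1 / c) * p (c *\<^sub>R x)"
    by (rule sublinearD(2)[OF assms(1)]) (use \<open>c > 0\<close> in simp)
  then have "c * p x \<le> p (c *\<^sub>R x)"
    using \<open>c > 0\<close> by (simp add: field_simps)
  then show ?thesis
    using sublinearD(2)[OF assms(1) \<open>c \<ge> 0\<close>, of x] by simp
qed

lemma sublinear_uminus:
  assumes "sublinear p"
  shows "- p (- x) \<le> p x"
  using sublinearD(1)[OF assms, of x "- x"] sublinear_scaleR[OF assms, of 0 0] by simp

text \<open>Take the infimum of \<open>p (x + t *\<^sub>R z) - t * p z\<close> over
  \<open>t \<ge> 0\<close>. The values \<open>t = 0\<close> and \<open>t = 1\<close> give the two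
  upper bounds, and \<open>- p (- x)\<close> is a lower bound for every \<open>t\<close>.\<close>

lemma sublinear_directional:
  fixes p :: "'a::real_vector \<Rightarrow> real"
  assumes p: "sublinear p"
  obtains q where "sublinear q" "q \<le> p" "\<And>x. q x \<le> p (x + z) - p z"
proof -
  define q where "q x = (INF t\<in>{0..}. p (x + t *\<^sub>R z) - t * p z)" for x
  have below: "- p (- x) \<le> p (x + t *\<^sub>R z) - t * p z" if "t \<ge> 0" for x t
  proof -
    have "p (t *\<^sub>R z) \<le> p (x + t *\<^sub>R z) + p (- x)"
      using sublinearD(1)[OF p, of "x + t *\<^sub>R z" "- x"] by simp
    then show ?thesis using sublinear_scaleR[OF p that, of z] by simp
  qed
  have bdd: "bdd_below ((\<lambda>t. p (x + t *\<^sub>R z) - t * p z) ` {0..})" for x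
    using below[of _ x] by (intro bdd_belowI[of _ "- p (- x)"]) auto
  have le: "q x \<le> p (x + t *\<^sub>R z) - t * p z" if "t \<ge> 0" for x t
    unfolding q_def by (rule cINF_lower[OF bdd]) (use that in simp)
  have ge: "c \<le> q x" if "\<And>t. t \<ge> 0 \<Longrightarrow> c \<le> p (x + t *\<^sub>R z) - t * p z" for c x
    unfolding q_def by (rule cINF_greatest) (use that in auto)
  have "q (x + y) \<le> q x + q y" for x y
  proof -
    have "q (x + y) - (p (x + s *\<^sub>R z) - s * p z) \<le> q y" if "s \<ge> 0" for s
    proof (rule ge)
      fix t :: real assume "t \<ge> 0"
      have "q (x + y) \<le> p ((x + y) + (s + t) *\<^sub>R z) - (s + t) * p z"
        using le[of "s + t" "x + y"] \<open>s \<ge> 0\<close> \<open>t \<ge> 0\<close> by simp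
      also have "(x + y) + (s + t) *\<^sub>R z = (x + s *\<^sub>R z) + (y + t *\<^sub>R z)"
        by (simp add: algebra_simps)
      also have "p \<dots> \<le> p (x + s *\<^sub>R z) + p (y + t *\<^sub>R z)"
        by (rule sublinearD(1)[OF p])
      finally show "q (x + y) - (p (x + s *\<^sub>R z) - s * p z) \<le> p (y + t *\<^sub>R z) - t * p z"
        by (simp add: algebra_simps)
    qed
    then have "q (x + y) - q y \<le> q x"
      by (intro ge) (simp add: algebra_simps)
    then show ?thesis by simp
  qed
  moreover have "q (c *\<^sub>R x) \<le> c * q x" if "c \<ge> 0" for c x
  proof (cases "c = 0")
    case True
    then show ?thesis
      using le[of 0 0] sublinear_scaleR[OF p, of 0 0] by simp
  next
    case False
    then have "c > 0" using that by simp
    have "q (c *\<^sub>R x) / c \<le> q x"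
    proof (rule ge)
      fix t :: real assume "t \<ge> 0"
      have "q (c *\<^sub>R x) \<le> p (c *\<^sub>R x + (c * t) *\<^sub>R z) - (c * t) * p z"
        using le[of "c * t"] \<open>c > 0\<close> \<open>t \<ge> 0\<close> by simp
      also have "c *\<^sub>R x + (c * t) *\<^sub>R z = c *\<^sub>R (x + t *\<^sub>R z)"
        by (simp add: algebra_simps)
      also have "p \<dots> = c * p (x + t *\<^sub>R z)"
        using sublinear_scaleR[OF p] \<open>c > 0\<close> by simp
      finally show "q (c *\<^sub>R x) / c \<le> p (x + t *\<^sub>R z) - t * p z"
        using \<open>c > 0\<close> by (simp add: field_simps)
    qed
    then show ?thesis using \<open>c > 0\<close> by (simp add: field_simps)
  qed
  ultimately have "sublinear q" by (simp add: sublinear_def)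
  moreover have "q \<le> p" using le[of 0] by (simp add: le_fun_def)
  moreover have "q x \<le> p (x + z) - p z" for x using le[of 1 x] by simp
  ultimately show thesis by (rule that)
qed

text \<open>A minimal sublinear functional coincides with all its directional minorants, which makes it
  additive.\<close>

lemma minimal_sublinear_linear:
  fixes m :: "'a::real_vector \<Rightarrow> real"
  assumes m: "sublinear m" and min: "\<And>q. sublinear q \<Longrightarrow> q \<le> m \<Longrightarrow> q = m"
  shows "linear m"
proof -
  have add: "m (x + z) = m x + m z" for x z
  proof -
    obtain q where "sublinear q" "q \<le> m" and q: "\<And>x. q x \<le> m (x + z) - m z"
      using sublinear_directional[OF m] by blast
    then have "m x \<le> m (x + z) - m z" using min q by metis
    then show ?thesis using sublinearD(1)[OF m, of x z] by simp
  qed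
  have neg: "m (- x) = - m x" for x
    using add[of x "- x"] sublinear_scaleR[OF m, of 0 0] by simp
  have "m (c *\<^sub>R x) = c * m x" for c x
  proof (cases "c \<ge> 0")
    case True
    then show ?thesis by (rule sublinear_scaleR[OF m])
  next
    case False
    then have "m ((- c) *\<^sub>R x) = (- c) * m x" by (intro sublinear_scaleR[OF m]) simp
    then show ?thesis using neg[of "c *\<^sub>R x"] by simp
  qed
  then show ?thesis by (intro linearI) (simp_all add: add)
qed

text \<open>Zorn's lemma, with the order reversed, yields a minimal sublinear functional below
  \<open>p\<close>, which is linear. The lower bound of a nonempty chain is its pointwise
  infimum.\<close>

lemma linear_below_sublinear:
  fixes p :: "'a::real_vector \<Rightarrow> real"
  assumes p: "sublinear p"
  obtains f where "linear f" "f \<le> p"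
proof -
  define A where "A = {q. sublinear q \<and> q \<le> p}"
  have "\<exists>m\<in>A. \<forall>q\<in>A. m \<ge> q \<longrightarrow> q = m"
  proof (rule predicate_Zorn[where P = "(\<ge>)"])
    show "partial_order_on A (relation_of (\<ge>) A)"
      by (rule partial_order_on_relation_ofI) auto
  next
    fix C assume C: "C \<in> Chains (relation_of (\<ge>) A)"
    have CA: "q \<in> A" if "q \<in> C" for q
      using C that by (auto simp: Chains_def relation_of_def)
    have total: "q \<le> r \<or> r \<le> q" if "q \<in> C" "r \<in> C" for q r
      using C that by (auto simp: Chains_def relation_of_def)
    show "\<exists>u\<in>A. \<forall>q\<in>C. q \<ge> u"
    proof (cases "C = {}")
      case True
      then show ?thesis using p by (auto simp: A_def)
    next
      case False
      define u where "u x = (INF q\<in>C. q x)" for x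
      have "- p (- x) \<le> q x" if "q \<in> C" for q x
      proof -
        have "q (- x) \<le> p (- x)" "- q (- x) \<le> q x"
          using CA[OF that] sublinear_uminus by (auto simp: A_def le_fun_def)
        then show ?thesis by simp
      qed
      then have bdd: "bdd_below ((\<lambda>q. q x) ` C)" for x
        by (intro bdd_belowI[of _ "- p (- x)"]) auto
      have le: "u x \<le> q x" if "q \<in> C" for q x
        unfolding u_def by (rule cINF_lower[OF bdd that])
      have ge: "c \<le> u x" if "\<And>q. q \<in> C \<Longrightarrow> c \<le> q x" for c x
        unfolding u_def by (rule cINF_greatest) (use that False in auto)
      have "u (x + y) \<le> u x + u y" for x y
      proof -
        have "u (x + y) - q x \<le> u y" if "q \<in> C" for q
        proof (rule ge)
          fix r assume "r \<in> C"
          \<comment> \<open>Subadditivity couples two infima over \<open>C\<close>. The smaller of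
            \<open>q\<close> and \<open>r\<close> serves for both summands at once.\<close>
          obtain s where s: "s \<in> C" "s \<le> q" "s \<le> r"
            using total \<open>q \<in> C\<close> \<open>r \<in> C\<close> by blast
          have "u (x + y) \<le> s (x + y)" by (rule le[OF s(1)])
          also have "\<dots> \<le> s x + s y" using CA[OF s(1)] sublinearD(1) by (auto simp: A_def)
          also have "\<dots> \<le> q x + r y" using s by (intro add_mono) (auto simp: le_fun_def)
          finally show "u (x + y) - q x \<le> r y" by simp
        qed
        then have "u (x + y) - u y \<le> u x"
          by (intro ge) (simp add: algebra_simps)
        then show ?thesis by simp
      qed
      moreover have "u (c *\<^sub>R x) \<le> c * u x" if "c \<ge> 0" for c x
      proof (cases "c = 0")
        case True
        obtain q where "q \<in> C" using False by blast
        then have "u 0 \<le> 0"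
          using le[of q 0] CA[of q] sublinear_scaleR[of q 0 0] by (auto simp: A_def)
        then show ?thesis using True by simp
      next
        case c: False
        then have "c > 0" using that by simp
        have "u (c *\<^sub>R x) / c \<le> u x"
        proof (rule ge)
          fix q assume "q \<in> C"
          have "u (c *\<^sub>R x) \<le> c * q x"
            using le[OF \<open>q \<in> C\<close>, of "c *\<^sub>R x"] CA[OF \<open>q \<in> C\<close>] sublinear_scaleR[of q c x] \<open>c > 0\<close>
            by (auto simp: A_def)
          then show "u (c *\<^sub>R x) / c \<le> q x" using \<open>c > 0\<close> by (simp add: field_simps)
        qed
        then show ?thesis using \<open>c > 0\<close> by (simp add: field_simps)
      qed
      ultimately have "sublinear u" by (simp add: sublinear_def)
      moreover have "u \<le> p"
      proof -
        obtain q where "q \<in> C" using False by blast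
        then have "u \<le> q" "q \<le> p" using le CA by (auto simp: le_fun_def A_def)
        then show ?thesis by simp
      qed
      ultimately show ?thesis using le by (auto simp: A_def le_fun_def)
    qed
  qed
  then obtain m where m: "sublinear m" "m \<le> p"
    and min: "\<And>q. sublinear q \<Longrightarrow> q \<le> p \<Longrightarrow> q \<le> m \<Longrightarrow> q = m"
    by (auto simp: A_def)
  have "linear m"
    using m min order_trans by (blast intro: minimal_sublinear_linear)
  then show thesis using m(2) by (rule that)
qed

text \<open>The directional minorant satisfies \<open>q (- z) \<le> - p z\<close>, so every linear
  functional below it is at least \<open>p z\<close> at \<open>z\<close>.\<close>

lemma linear_below_sublinear_at:
  fixes p :: "'a::real_vector \<Rightarrow> real"
  assumes p: "sublinear p"
  obtains f where "linear f" "f \<le> p" "f z = p z"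
proof -
  obtain q where q: "sublinear q" "q \<le> p" "\<And>x. q x \<le> p (x + z) - p z"
    using sublinear_directional[OF p] by blast
  obtain f where f: "linear f" "f \<le> q" using linear_below_sublinear[OF q(1)] .
  have "- f z = f (- z)" using f(1) by (simp add: linear_neg)
  also have "\<dots> \<le> q (- z)" using f(2) by (simp add: le_fun_def)
  also have "\<dots> \<le> - p z" using q(3)[of "- z"] sublinear_scaleR[OF p, of 0 0] by simp
  finally have "f z \<ge> p z" by simp
  moreover have "f \<le> p" using f(2) q(2) by simp
  ultimately show thesis using that[of f] f(1) by (simp add: le_fun_def antisym)
qed

section \<open>Minkowski functionals and separation of points\<close>

definition minkowski :: "'a::real_vector set \<Rightarrow> 'a \<Rightarrow> real" where
  "minkowski V x = Inf {t. t > 0 \<and> (1 / t) *\<^sub>R x \<in> V}"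

lemma neighbourhood_0_absorbing:
  fixes V :: "'a::topological_real_vector set"
  assumes "open V" "0 \<in> V"
  obtains t where "t > 0" "(1 / t) *\<^sub>R x \<in> V"
proof -
  have "((\<lambda>n. (1 / real (Suc n)) *\<^sub>R x) \<longlongrightarrow> 0 *\<^sub>R x) sequentially"
    by (intro tendsto_scaleR_topological tendsto_const LIMSEQ_Suc lim_1_over_n)
  then have "eventually (\<lambda>n. (1 / real (Suc n)) *\<^sub>R x \<in> V) sequentially"
    using assms by (intro topological_tendstoD) auto
  then obtain n where "(1 / real (Suc n)) *\<^sub>R x \<in> V"
    by (auto simp: eventually_sequentially)
  then show thesis by (intro that[of "real (Suc n)"]) auto
qed

lemma minkowski_le:
  assumes "t > 0" "(1 / t) *\<^sub>R x \<in> V"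
  shows "minkowski V x \<le> t"
  unfolding minkowski_def using assms by (intro cInf_lower bdd_belowI[of _ 0]) auto

lemma minkowski_ge:
  fixes V :: "'a::topological_real_vector set"
  assumes "open V" "0 \<in> V" "\<And>t. t > 0 \<Longrightarrow> (1 / t) *\<^sub>R x \<in> V \<Longrightarrow> c \<le> t"
  shows "c \<le> minkowski V x"
  unfolding minkowski_def
proof (rule cInf_greatest)
  show "{t. t > 0 \<and> (1 / t) *\<^sub>R x \<in> V} \<noteq> {}"
    using neighbourhood_0_absorbing[OF assms(1,2)] by blast
qed (use assms(3) in auto)

lemma sublinear_minkowski:
  fixes V :: "'a::topological_real_vector set"
  assumes V: "open V" "0 \<in> V" and "convex V"
  shows "sublinear (minkowski V)"
proof -
  have "minkowski V (x + y) \<le> minkowski V x + minkowski V y" for x y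
  proof -
    have "minkowski V (x + y) - s \<le> minkowski V y" if s: "s > 0" "(1 / s) *\<^sub>R x \<in> V" for s
    proof (rule minkowski_ge[OF V])
      fix t :: real assume t: "t > 0" "(1 / t) *\<^sub>R y \<in> V"
      \<comment> \<open>The weights are chosen so that this convex combination of
        \<open>x / s\<close> and \<open>y / t\<close> is \<open>(x + y) / (s + t)\<close>.\<close>
      have "(s / (s + t)) *\<^sub>R ((1 / s) *\<^sub>R x) + (t / (s + t)) *\<^sub>R ((1 / t) *\<^sub>R y) \<in> V"
        using s t by (intro convexD[OF \<open>convex V\<close>]) (auto simp: add_divide_distrib[symmetric])
      then have "(1 / (s + t)) *\<^sub>R (x + y) \<in> V"
        using s t by (simp add: scaleR_add_right)
      then have "minkowski V (x + y) \<le> s + t" using s t by (intro minkowski_le) auto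
      then show "minkowski V (x + y) - s \<le> t" by simp
    qed
    then have "minkowski V (x + y) - minkowski V y \<le> minkowski V x"
      by (intro minkowski_ge[OF V]) (simp add: algebra_simps)
    then show ?thesis by simp
  qed
  moreover have "minkowski V (c *\<^sub>R x) \<le> c * minkowski V x" if "c \<ge> 0" for c x
  proof (cases "c = 0")
    case True
    \<comment> \<open>Since \<open>0 \<in> V\<close>, every positive \<open>t\<close> is admissible
      in the infimum.\<close>
    have "minkowski V 0 \<le> 0"
      by (rule field_le_epsilon) (use V in \<open>auto intro: minkowski_le\<close>)
    then show ?thesis using True by simp
  next
    case False
    then have "c > 0" using that by simp
    have "minkowski V (c *\<^sub>R x) / c \<le> minkowski V x"
    proof (rule minkowski_ge[OF V])
      fix t :: real assume "t > 0" "(1 / t) *\<^sub>R x \<in> V"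
      then have "minkowski V (c *\<^sub>R x) \<le> c * t"
        using \<open>c > 0\<close> by (intro minkowski_le) auto
      then show "minkowski V (c *\<^sub>R x) / c \<le> t" using \<open>c > 0\<close> by (simp add: field_simps)
    qed
    then show ?thesis using \<open>c > 0\<close> by (simp add: field_simps)
  qed
  ultimately show ?thesis by (simp add: sublinear_def)
qed

lemma continuous_on_linear_bounded_near_0:
  fixes f :: "'a::topological_real_vector \<Rightarrow> real"
  assumes "linear f" and V: "open V" "0 \<in> V" and bound: "\<And>x. x \<in> V \<Longrightarrow> f x \<le> 1"
  shows "continuous_on UNIV f"
  unfolding continuous_on_def
proof
  fix x
  \<comment> \<open>Taking \<open>c = 1\<close> and \<open>c = -1\<close> yields both sides of the
    estimate from the one-sided bound on \<open>V\<close>. The factor \<open>2\<close> below makes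
    the inequality strict.\<close>
  have small: "\<forall>\<^sub>F y in at x. c * (f y - f x) < e" if "e > 0" for c e
  proof -
    have "((\<lambda>y. (2 * c / e) *\<^sub>R (y - x)) \<longlongrightarrow> (2 * c / e) *\<^sub>R (x - x)) (at x)"
      by (intro tendsto_scaleR_topological tendsto_const tendsto_diff tendsto_ident_at)
    then have "\<forall>\<^sub>F y in at x. (2 * c / e) *\<^sub>R (y - x) \<in> V"
      using V by (intro topological_tendstoD) auto
    then show ?thesis
    proof eventually_elim
      case (elim y)
      then have "(2 * c / e) * (f y - f x) \<le> 1"
        using bound[OF elim] by (simp only: linear_scale[OF \<open>linear f\<close>] linear_diff[OF \<open>linear f\<close>] real_scaleR_def)
      then have "2 * (c * (f y - f x)) \<le> e" using \<open>e > 0\<close> by (simp add: field_simps)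
      then show ?case using \<open>e > 0\<close> by simp
    qed
  qed
  show "(f \<longlongrightarrow> f x) (at x within UNIV)"
  proof (rule tendstoI)
    fix e :: real assume "e > 0"
    show "\<forall>\<^sub>F y in at x. dist (f y) (f x) < e"
      using small[OF \<open>e > 0\<close>, of 1] small[OF \<open>e > 0\<close>, of "-1"]
      by eventually_elim (simp add: dist_real_def)
  qed
qed

text \<open>Choose a convex neighbourhood \<open>V\<close> of \<open>0\<close> that misses
  \<open>x - y\<close>. A linear functional below the Minkowski functional of \<open>V\<close> and
  equal to it at \<open>x - y\<close> is at most \<open>1\<close> on \<open>V\<close>, hence
  continuous, and at least \<open>1\<close> at \<open>x - y\<close>.\<close>

lemma continuous_linear_separation:
  fixes x y :: "'a::hausdorff_locally_convex"
  assumes "x \<noteq> y"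
  obtains f :: "'a \<Rightarrow> real" where "linear f" "continuous_on UNIV f" "f x \<noteq> f y"
proof -
  obtain U :: "'a set" where "open U" "0 \<in> U" "x - y \<notin> U"
    using assms t1_space[of 0 "x - y"] by auto
  then obtain V where V: "open V" "0 \<in> V" "convex V" "V \<subseteq> U"
    using convex_open_neighbourhood_0 by metis
  then have "x - y \<notin> V" using \<open>x - y \<notin> U\<close> by blast
  have "1 \<le> minkowski V (x - y)"
  proof (rule minkowski_ge[OF V(1,2)], rule ccontr)
    fix t :: real assume t: "t > 0" "(1 / t) *\<^sub>R (x - y) \<in> V" "\<not> 1 \<le> t"
    have "t *\<^sub>R ((1 / t) *\<^sub>R (x - y)) + (1 - t) *\<^sub>R 0 \<in> V"
      using t V(2) by (intro convexD[OF V(3)]) auto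
    then show False using t \<open>x - y \<notin> V\<close> by simp
  qed
  obtain f where f: "linear f" "f \<le> minkowski V" "f (x - y) = minkowski V (x - y)"
    using linear_below_sublinear_at[OF sublinear_minkowski[OF V(1-3)]] .
  have "f v \<le> 1" if "v \<in> V" for v
    using f(2) minkowski_le[of 1 v V] that by (auto simp: le_fun_def intro: order_trans)
  then have "continuous_on UNIV f"
    by (rule continuous_on_linear_bounded_near_0[OF f(1) V(1,2)])
  moreover have "f x \<noteq> f y"
    using f \<open>1 \<le> minkowski V (x - y)\<close> by (simp add: linear_diff)
  ultimately show thesis by (rule that[OF f(1)])
qed

section \<open>Affine maps on convex sets\<close>

lemma affine_onD:
  assumes "affine_on X f" "x \<in> X" "y \<in> X" "0 \<le> t" "t \<le> 1"
  shows "f ((1 - t) *\<^sub>R x + t *\<^sub>R y) = (1 - t) *\<^sub>R f x + t *\<^sub>R f y"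
  using assms by (auto simp: affine_on_def)

lemma convexD_weight:
  assumes "convex X" "x \<in> X" "y \<in> X" "0 \<le> t" "t \<le> 1"
  shows "(1 - t) *\<^sub>R x + t *\<^sub>R y \<in> X"
  using assms by (intro convexD) auto

lemma cont_affineD:
  assumes "f \<in> cont_affine X"
  shows "f \<in> extensional X" "continuous_on X f" "affine_on X f"
  using assms by (auto simp: cont_affine_def)

lemma restrict_cont_affine:
  assumes "continuous_on X f" "affine_on X f" "convex X"
  shows "restrict f X \<in> cont_affine X"
  using assms
  by (auto simp: cont_affine_def affine_on_def convexD_weight cong: continuous_on_cong)

lemma cont_affine_const: "convex X \<Longrightarrow> (\<lambda>x\<in>X. c::real) \<in> cont_affine X"
  by (intro restrict_cont_affine) (auto simp: affine_on_def algebra_simps)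

lemma cont_affine_sum:
  fixes d :: "('a::{topological_space, real_vector} \<Rightarrow> real) \<Rightarrow> real"
  assumes "convex X" "G \<subseteq> cont_affine X"
  shows "(\<lambda>x\<in>X. \<Sum>g\<in>G. d g * g x) \<in> cont_affine X"
proof (intro restrict_cont_affine \<open>convex X\<close>)
  show "continuous_on X (\<lambda>x. \<Sum>g\<in>G. d g * g x)"
    using assms cont_affineD(2) by (intro continuous_intros) blast
  show "affine_on X (\<lambda>x. \<Sum>g\<in>G. d g * g x)"
    unfolding affine_on_def
  proof (intro ballI)
    fix x y t assume *: "x \<in> X" "y \<in> X" "t \<in> {0..1::real}"
    have "(\<Sum>g\<in>G. d g * g ((1 - t) *\<^sub>R x + t *\<^sub>R y)) =
        (\<Sum>g\<in>G. (1 - t) * (d g * g x) + t * (d g * g y))"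
    proof (rule sum.cong[OF refl])
      fix g assume "g \<in> G"
      then have "affine_on X g" using assms cont_affineD(3) by blast
      then show "d g * g ((1 - t) *\<^sub>R x + t *\<^sub>R y) = (1 - t) * (d g * g x) + t * (d g * g y)"
        using * affine_onD[of X g x y t] by (simp add: distrib_left mult.left_commute)
    qed
    then show "(\<Sum>g\<in>G. d g * g ((1 - t) *\<^sub>R x + t *\<^sub>R y)) =
        (1 - t) *\<^sub>R (\<Sum>g\<in>G. d g * g x) + t *\<^sub>R (\<Sum>g\<in>G. d g * g y)"
      by (simp add: sum.distrib sum_distrib_left)
  qed
qed

text \<open>Restrictions of continuous linear functionals are affine. This turns equalities tested
  on real affine functions into equalities of points, to which vector-valued maps can then be
  applied.\<close>

lemma cont_affine_separation:
  fixes X :: "'a::hausdorff_locally_convex set"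
  assumes "convex X" "x \<in> X" "y \<in> X" "\<And>g. g \<in> cont_affine X \<Longrightarrow> g x = (g y::real)"
  shows "x = y"
proof (rule ccontr)
  assume "x \<noteq> y"
  then obtain f :: "'a \<Rightarrow> real" where f: "linear f" "continuous_on UNIV f" "f x \<noteq> f y"
    by (rule continuous_linear_separation)
  have "affine_on X f" using f(1) by (simp add: affine_on_def linear_add linear_scale)
  then have "restrict f X \<in> cont_affine X"
    using f(2) \<open>convex X\<close> by (intro restrict_cont_affine continuous_on_subset[OF f(2)]) auto
  then have "restrict f X x = restrict f X y" by (rule assms(4))
  then show False using assms(2,3) f(3) by simp
qed

text \<open>The barycentre of mass \<open>a\<close> at \<open>x\<close> and mass \<open>b\<close> at
  \<open>y\<close>, in the weight format of \<open>affine_on\<close>. At total mass \<open>0\<close>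
  the default \<open>x\<close> keeps the value in \<open>X\<close>.\<close>

definition bary :: "real \<Rightarrow> 'a::real_vector \<Rightarrow> real \<Rightarrow> 'a \<Rightarrow> 'a" where
  "bary a x b y = (if a + b = 0 then x else (1 - b / (a + b)) *\<^sub>R x + (b / (a + b)) *\<^sub>R y)"

lemma bary_in:
  assumes "convex X" "x \<in> X" "y \<in> X" "a \<ge> 0" "b \<ge> 0"
  shows "bary a x b y \<in> X"
  using assms by (auto simp: bary_def intro!: convexD_weight divide_nonneg_nonneg)

lemma affine_on_bary:
  assumes "affine_on X f" "x \<in> X" "y \<in> X" "a \<ge> 0" "b \<ge> 0"
  shows "(a + b) *\<^sub>R f (bary a x b y) = a *\<^sub>R f x + b *\<^sub>R f y"
proof (cases "a + b = 0")
  case True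
  then have "a = 0" "b = 0" using assms(4,5) by auto
  then show ?thesis by simp
next
  case False
  then have "a + b > 0" using assms(4,5) by simp
  then have "f (bary a x b y) = (1 - b / (a + b)) *\<^sub>R f x + (b / (a + b)) *\<^sub>R f y"
    using assms by (auto simp: bary_def intro!: affine_onD[OF assms(1)])
  then show ?thesis
    using \<open>a + b > 0\<close> by (simp add: scaleR_add_right right_diff_distrib)
qed

section \<open>Differences of point evaluations\<close>

text \<open>The quadruple \<open>(a, x, b, z)\<close> encodes the functional \<open>a \<delta>\<^sub>x - b \<delta>\<^sub>z\<close>.\<close>

definition ev :: "('a \<Rightarrow> 'b::real_vector) \<Rightarrow> real \<times> 'a \<times> real \<times> 'a \<Rightarrow> 'b" where
  "ev f = (\<lambda>(a, x, b, z). a *\<^sub>R f x - b *\<^sub>R f z)"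

definition ev_box :: "real \<Rightarrow> 'a set \<Rightarrow> (real \<times> 'a \<times> real \<times> 'a) set" where
  "ev_box K X = {0..K} \<times> X \<times> {0..K} \<times> X"

text \<open>Convex combinations of the encoded functionals: the positive parts and the negative
  parts are merged separately, each into a single point mass at a barycentre.\<close>

definition ev_mix :: "real \<Rightarrow> real \<times> 'a::real_vector \<times> real \<times> 'a
    \<Rightarrow> real \<times> 'a \<times> real \<times> 'a \<Rightarrow> real \<times> 'a \<times> real \<times> 'a" where
  "ev_mix t = (\<lambda>(a, x, b, z) (a', x', b', z').
     ((1 - t) * a + t * a', bary ((1 - t) * a) x (t * a') x',
      (1 - t) * b + t * b', bary ((1 - t) * b) z (t * b') z'))"

lemma ev_mix_in:
  assumes "convex X" "p \<in> ev_box K X" "q \<in> ev_box K X" "0 \<le> t" "t \<le> 1"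
  shows "ev_mix t p q \<in> ev_box K X"
proof -
  have le: "(1 - t) * a + t * a' \<le> K" if "a \<le> K" "a' \<le> K" for a a'
    using convex_bound_le[OF that, of "1 - t" t] assms by simp
  show ?thesis
    using assms by (auto simp: ev_mix_def ev_box_def intro!: bary_in le)
qed

lemma ev_mix:
  assumes "affine_on X f" "p \<in> ev_box K X" "q \<in> ev_box K X" "0 \<le> t" "t \<le> 1"
  shows "ev f (ev_mix t p q) = (1 - t) *\<^sub>R ev f p + t *\<^sub>R ev f q"
  using assms
  by (auto simp: ev_mix_def ev_box_def ev_def affine_on_bary scaleR_diff_right)

lemma continuous_on_ev:
  fixes f :: "'a::topological_space \<Rightarrow> 'b::topological_real_vector"
  assumes "continuous_on X f"
  shows "continuous_on (ev_box K X) (ev f)"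
proof -
  have "continuous_on (ev_box K X)
      (\<lambda>p. fst p *\<^sub>R f (fst (snd p)) - fst (snd (snd p)) *\<^sub>R f (snd (snd (snd p))))"
    by (intro continuous_on_diff continuous_on_scaleR_topological continuous_intros
        continuous_on_compose2[OF assms]) (auto simp: ev_box_def)
  then show ?thesis by (simp add: ev_def case_prod_unfold)
qed

lemma compact_ev_box: "compact X \<Longrightarrow> compact (ev_box K X)"
  by (simp add: ev_box_def compact_Times)

text \<open>\<open>a \<delta>\<^sub>x - b \<delta>\<^sub>z = c \<delta>\<^sub>u - d \<delta>\<^sub>v\<close> amounts to the equality of the barycentre of \<open>a\<close> at \<open>x\<close> and
  \<open>d\<close> at \<open>v\<close> with that of \<open>c\<close> at \<open>u\<close> and \<open>b\<close> at \<open>z\<close>.\<close>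

lemma ev_unique:
  fixes X :: "'a::hausdorff_locally_convex set" and f :: "'a \<Rightarrow> 'b::real_vector"
  assumes X: "convex X" and f: "affine_on X f" and pq: "p \<in> ev_box K X" "q \<in> ev_box K X"
    and eq: "\<And>g. g \<in> cont_affine X \<Longrightarrow> ev g p = (ev g q :: real)"
  shows "ev f p = ev f q"
proof -
  obtain a x b z where p: "p = (a, x, b, z)" by (cases p) auto
  obtain c u d v where q: "q = (c, u, d, v)" by (cases q) auto
  have in_X: "x \<in> X" "z \<in> X" "u \<in> X" "v \<in> X" and pos: "a \<ge> 0" "b \<ge> 0" "c \<ge> 0" "d \<ge> 0"
    using pq by (auto simp: p q ev_box_def)
  \<comment> \<open>Testing on the constant function \<open>1\<close> compares the total
    masses.\<close>
  have mass: "a + d = c + b"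
    using eq[OF cont_affine_const[OF X, of 1]] in_X by (simp add: p q ev_def)
  have "(a + d) *\<^sub>R f (bary a x d v) = (c + b) *\<^sub>R f (bary c u b z)"
  proof (cases "a + d = 0")
    case True
    then show ?thesis using mass by simp
  next
    case False
    have "bary a x d v = bary c u b z"
    proof (rule cont_affine_separation[OF X])
      fix g :: "'a \<Rightarrow> real" assume g: "g \<in> cont_affine X"
      have "(a + d) * g (bary a x d v) = (c + b) * g (bary c u b z)"
        using affine_on_bary[OF cont_affineD(3)[OF g], of x v a d]
          affine_on_bary[OF cont_affineD(3)[OF g], of u z c b] eq[OF g] in_X pos
        by (simp add: p q ev_def)
      then show "g (bary a x d v) = g (bary c u b z)" using False mass by simp
    qed (use X in_X pos in \<open>auto intro: bary_in\<close>)
    then show ?thesis using mass by simp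
  qed
  then have "a *\<^sub>R f x + d *\<^sub>R f v = c *\<^sub>R f u + b *\<^sub>R f z"
    using f in_X pos by (simp add: affine_on_bary)
  then show ?thesis by (simp add: p q ev_def algebra_simps)
qed

section \<open>Bounded functionals are differences of point evaluations\<close>

lemma sup_norm_le:
  assumes "B \<ge> 0" "\<And>x. x \<in> X \<Longrightarrow> \<bar>f x\<bar> \<le> B"
  shows "sup_norm X f \<le> B"
  unfolding sup_norm_def by (rule cSup_least) (use assms in auto)

lemma le_sup_norm:
  assumes "compact X" "continuous_on X f" "x \<in> X"
  shows "\<bar>f x\<bar> \<le> sup_norm X f"
proof -
  have "bounded ((\<lambda>x. \<bar>f x\<bar>) ` X)"
    using assms by (intro compact_imp_bounded compact_continuous_image continuous_intros)
  then show ?thesis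
    unfolding sup_norm_def using assms(3) by (intro cSup_upper bounded_imp_bdd_above) auto
qed

text \<open>A least-squares approximation of \<open>L\<close> on finitely many functions \<open>g\<close> is exact: otherwise its
  residuals are the coefficients of a function on which \<open>L\<close> violates the norm bound.\<close>

lemma finite_representation:
  fixes X :: "'a::hausdorff_locally_convex set" and L :: "('a \<Rightarrow> real) \<Rightarrow> real"
  assumes X: "compact X" "convex X" "X \<noteq> {}" and "K \<ge> 0"
    and L: "\<And>d. L (\<lambda>x\<in>X. \<Sum>g\<in>G. d g * g x) = (\<Sum>g\<in>G. d g * L g)"
    and bound: "\<And>g. g \<in> cont_affine X \<Longrightarrow> \<bar>L g\<bar> \<le> K * sup_norm X g"
    and G: "finite G" "G \<subseteq> cont_affine X"
  shows "\<exists>p\<in>ev_box K X. \<forall>g\<in>G. ev g p = L g"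
proof -
  let ?C = "ev_box K X"
  have "?C \<noteq> {}" using X(3) \<open>K \<ge> 0\<close> by (auto simp: ev_box_def)
  moreover have "continuous_on ?C (\<lambda>p. \<Sum>g\<in>G. (L g - ev g p)\<^sup>2)"
    using G cont_affineD(2) by (intro continuous_intros continuous_on_ev) blast
  ultimately have "\<exists>p\<in>?C. \<forall>q\<in>?C. (\<Sum>g\<in>G. (L g - ev g p)\<^sup>2) \<le> (\<Sum>g\<in>G. (L g - ev g q)\<^sup>2)"
    by (rule continuous_attains_inf[OF compact_ev_box[OF X(1)]])
  then obtain p where p: "p \<in> ?C"
    and min: "\<And>q. q \<in> ?C \<Longrightarrow> (\<Sum>g\<in>G. (L g - ev g p)\<^sup>2) \<le> (\<Sum>g\<in>G. (L g - ev g q)\<^sup>2)"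
    by blast
  define d where "d g = L g - ev g p" for g
  define h where "h = (\<lambda>x\<in>X. \<Sum>g\<in>G. d g * g x)"
  have h: "h \<in> cont_affine X"
    unfolding h_def using X(2) G(2) by (rule cont_affine_sum)
  have ev_h: "ev h q = (\<Sum>g\<in>G. d g * ev g q)" if "q \<in> ?C" for q
    using that by (auto simp: ev_box_def ev_def h_def sum_distrib_left sum_subtractf
        right_diff_distrib mult.left_commute)
  \<comment> \<open>First-order condition at the minimiser \<open>p\<close>: moving towards
    \<open>q\<close> along \<open>ev_mix\<close> cannot decrease the squared error, so the
    derivative \<open>-2 * D\<close> at \<open>t = 0\<close> is nonnegative.\<close>
  have opt: "ev h q \<le> ev h p" if q: "q \<in> ?C" for q
  proof -
    define e where "e g = ev g q - ev g p" for g :: "'a \<Rightarrow> real"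
    define D where "D = (\<Sum>g\<in>G. d g * e g)"
    define E where "E = (\<Sum>g\<in>G. (e g)\<^sup>2)"
    have "E \<ge> 0" by (simp add: E_def sum_nonneg)
    have step: "2 * D \<le> t * E" if t: "0 < t" "t \<le> 1" for t
    proof -
      have "(\<Sum>g\<in>G. (d g)\<^sup>2) \<le> (\<Sum>g\<in>G. (L g - ev g (ev_mix t p q))\<^sup>2)"
        unfolding d_def by (intro min ev_mix_in X(2) p q) (use t in auto)
      also have "\<dots> = (\<Sum>g\<in>G. (d g)\<^sup>2 - 2 * t * (d g * e g) + t\<^sup>2 * (e g)\<^sup>2)"
      proof (rule sum.cong[OF refl])
        fix g assume "g \<in> G"
        then have "affine_on X g" using G(2) cont_affineD(3) by blast
        then have "L g - ev g (ev_mix t p q) = d g - t * e g"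
          using p q t by (simp add: ev_mix d_def e_def algebra_simps)
        then show "(L g - ev g (ev_mix t p q))\<^sup>2 = (d g)\<^sup>2 - 2 * t * (d g * e g) + t\<^sup>2 * (e g)\<^sup>2"
          by (simp only: power2_diff power_mult_distrib) (simp add: mult_ac)
      qed
      also have "\<dots> = (\<Sum>g\<in>G. (d g)\<^sup>2) - 2 * t * D + t\<^sup>2 * E"
        by (simp add: D_def E_def sum.distrib sum_subtractf sum_distrib_left)
      finally have "t * (2 * D) \<le> t * (t * E)" by (simp add: power2_eq_square)
      then show ?thesis using t by simp
    qed
    have "D \<le> 0"
    proof (rule ccontr)
      assume "\<not> D \<le> 0"
      then have "D > 0" by simp
      moreover have "E > 0" using step[of 1] \<open>D > 0\<close> by simp
      \<comment> \<open>This step length turns the estimate into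
        \<open>2 * D \<le> D\<close>.\<close>
      ultimately have "2 * D \<le> min 1 (D / E) * E" by (intro step) auto
      also have "\<dots> \<le> (D / E) * E" using \<open>E > 0\<close> by (intro mult_right_mono) auto
      finally show False using \<open>D > 0\<close> \<open>E > 0\<close> by simp
    qed
    then show ?thesis
      by (simp add: ev_h p q D_def e_def right_diff_distrib sum_subtractf)
  qed
  have "continuous_on X (\<lambda>x. \<bar>h x\<bar>)"
    using cont_affineD(2)[OF h] by (intro continuous_intros)
  then have "\<exists>x\<in>X. \<forall>y\<in>X. \<bar>h y\<bar> \<le> \<bar>h x\<bar>"
    by (rule continuous_attains_sup[OF X(1,3)])
  then obtain x where x: "x \<in> X" "\<And>y. y \<in> X \<Longrightarrow> \<bar>h y\<bar> \<le> \<bar>h x\<bar>" by blast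
  \<comment> \<open>Compare \<open>p\<close> with the full mass \<open>K\<close> placed at a maximum
    point of \<open>\<bar>h\<bar>\<close>, on the positive or negative side according to the sign of
    \<open>h x\<close>.\<close>
  have "K * \<bar>h x\<bar> \<le> ev h p"
  proof (cases "h x \<ge> 0")
    case True
    then show ?thesis
      using opt[of "(K, x, 0, x)"] x(1) \<open>K \<ge> 0\<close> by (simp add: ev_def ev_box_def)
  next
    case False
    then show ?thesis
      using opt[of "(0, x, K, x)"] x(1) \<open>K \<ge> 0\<close> by (simp add: ev_def ev_box_def)
  qed
  moreover have "L h \<le> K * \<bar>h x\<bar>"
  proof -
    have "sup_norm X h \<le> \<bar>h x\<bar>" using x(2) by (intro sup_norm_le) auto
    then have "K * sup_norm X h \<le> K * \<bar>h x\<bar>" using \<open>K \<ge> 0\<close> by (rule mult_left_mono)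
    then show ?thesis using bound[OF h] by simp
  qed
  moreover have "L h - ev h p = (\<Sum>g\<in>G. (d g)\<^sup>2)"
  proof -
    have "L h = (\<Sum>g\<in>G. d g * L g)" unfolding h_def by (rule L)
    then show ?thesis
      by (simp only: ev_h[OF p] sum_subtractf[symmetric] right_diff_distrib[symmetric] d_def
          power2_eq_square)
  qed
  ultimately have "(\<Sum>g\<in>G. (d g)\<^sup>2) \<le> 0" by simp
  then have "(\<Sum>g\<in>G. (d g)\<^sup>2) = 0" by (intro order_antisym sum_nonneg) auto
  then have "\<forall>g\<in>G. d g = 0" using G(1) by (simp add: sum_nonneg_eq_0_iff)
  then show ?thesis using p by (auto simp: d_def)
qed

lemma functional_sum:
  fixes L :: "('a::{topological_space, real_vector} \<Rightarrow> real) \<Rightarrow> real"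
  assumes X: "convex X"
    and add: "\<And>g h. g \<in> cont_affine X \<Longrightarrow> h \<in> cont_affine X \<Longrightarrow> L (\<lambda>x\<in>X. g x + h x) = L g + L h"
    and scale: "\<And>c g. g \<in> cont_affine X \<Longrightarrow> L (\<lambda>x\<in>X. c * g x) = c * L g"
    and G: "finite G" "G \<subseteq> cont_affine X"
  shows "L (\<lambda>x\<in>X. \<Sum>g\<in>G. d g * g x) = (\<Sum>g\<in>G. d g * L g)"
  using G
proof (induction G rule: finite_induct)
  case empty
  \<comment> \<open>Writing the zero function as \<open>0\<close> times itself lets homogeneity give
    its value under \<open>L\<close>.\<close>
  have "(\<lambda>x\<in>X. 0 * (\<lambda>x\<in>X. 0::real) x) = (\<lambda>x\<in>X. 0)" by auto
  then show ?case using scale[OF cont_affine_const[OF X, of 0], of 0]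
    by (simp only: sum.empty mult_zero_left)
next
  case (insert g G)
  have g: "(\<lambda>x\<in>X. d g * g x) \<in> cont_affine X"
    using cont_affine_sum[OF X, of "{g}" d] insert.prems by simp
  have G: "(\<lambda>x\<in>X. \<Sum>g\<in>G. d g * g x) \<in> cont_affine X"
    using cont_affine_sum[OF X, of G d] insert.prems by simp
  have "L (\<lambda>x\<in>X. \<Sum>g\<in>insert g G. d g * g x) =
      L (\<lambda>x\<in>X. (\<lambda>x\<in>X. d g * g x) x + (\<lambda>x\<in>X. \<Sum>g\<in>G. d g * g x) x)"
    using insert.hyps by (intro arg_cong[of _ _ L] restrict_ext) simp
  also have "\<dots> = d g * L g + (\<Sum>g\<in>G. d g * L g)"
  proof -
    have IH: "L (\<lambda>x\<in>X. \<Sum>g\<in>G. d g * g x) = (\<Sum>g\<in>G. d g * L g)"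
      by (rule insert.IH) (use insert.prems in simp)
    have "L (\<lambda>x\<in>X. d g * g x) = d g * L g" by (rule scale) (use insert.prems in simp)
    then show ?thesis by (simp only: add[OF g G] IH)
  qed
  finally show ?case by (simp only: sum.insert[OF insert.hyps])
qed

text \<open>For each \<open>g\<close> the parameters with the correct value at \<open>g\<close> form
  a closed subset of the compact box. Finitely many of these sets meet by
  \<open>finite_representation\<close>, so all of them do.\<close>

lemma bounded_functional_representation:
  fixes X :: "'a::hausdorff_locally_convex set" and L :: "('a \<Rightarrow> real) \<Rightarrow> real"
  assumes X: "compact X" "convex X" "X \<noteq> {}" and "K \<ge> 0"
    and add: "\<And>g h. g \<in> cont_affine X \<Longrightarrow> h \<in> cont_affine X \<Longrightarrow> L (\<lambda>x\<in>X. g x + h x) = L g + L h"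
    and scale: "\<And>c g. g \<in> cont_affine X \<Longrightarrow> L (\<lambda>x\<in>X. c * g x) = c * L g"
    and bound: "\<And>g. g \<in> cont_affine X \<Longrightarrow> \<bar>L g\<bar> \<le> K * sup_norm X g"
  shows "\<exists>p\<in>ev_box K X. \<forall>g\<in>cont_affine X. ev g p = L g"
proof -
  let ?C = "ev_box K X"
  let ?S = "\<lambda>g. ?C \<inter> ev g -` {L g}"
  have "?C \<inter> (\<Inter>g\<in>cont_affine X. ?S g) \<noteq> {}"
  proof (rule compact_imp_fip_image)
    show "compact ?C" by (rule compact_ev_box[OF X(1)])
    then have "closed ?C" by (rule compact_imp_closed)
    then show "closed (?S g)" if "g \<in> cont_affine X" for g
      using cont_affineD(2)[OF that] by (intro continuous_closed_preimage continuous_on_ev) auto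
  next
    fix G :: "('a \<Rightarrow> real) set" assume G: "finite G" "G \<subseteq> cont_affine X"
    have "\<exists>p\<in>?C. \<forall>g\<in>G. ev g p = L g"
      by (rule finite_representation[OF X \<open>K \<ge> 0\<close> functional_sum[OF X(2) add scale G] bound G])
    then show "?C \<inter> (\<Inter>g\<in>G. ?S g) \<noteq> {}" by blast
  qed
  then show ?thesis by blast
qed

section \<open>Affine defects of Baire maps\<close>

lemma tendsto_ev:
  fixes f :: "'a \<Rightarrow> 'b::topological_real_vector"
  assumes "\<And>x. x \<in> X \<Longrightarrow> (\<lambda>n. g n x) \<longlonglongrightarrow> f x" "p \<in> ev_box K X"
  shows "(\<lambda>n. ev (g n) p) \<longlonglongrightarrow> ev f p"
  using assms
  by (auto simp: ev_def ev_box_def intro!: tendsto_diff tendsto_scaleR_topological)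

text \<open>Every open set containing \<open>d\<close> contains \<open>0\<close>. This allows a
  limit to be shifted by an element of \<open>closure {0}\<close>.\<close>

lemma tendsto_closure_0:
  fixes d :: "'a::{topological_space, zero}"
  assumes "d \<in> closure {0}"
  shows "((\<lambda>_. 0) \<longlongrightarrow> d) F"
proof (rule topological_tendstoI)
  fix S :: "'a set" assume "open S" "d \<in> S"
  then have "0 \<in> S" using assms open_Int_closure_eq_empty[of S "{0}"] by blast
  then show "\<forall>\<^sub>F _ in F. 0 \<in> S" by simp
qed

definition affine_defect :: "('a::real_vector \<Rightarrow> 'b::real_vector) \<Rightarrow> 'a \<Rightarrow> 'a \<Rightarrow> real \<Rightarrow> 'b" where
  "affine_defect f x y t = f ((1 - t) *\<^sub>R x + t *\<^sub>R y) - ((1 - t) *\<^sub>R f x + t *\<^sub>R f y)"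

lemma affine_baire_0: "affine_baire 0 X = cont_affine X"
  by (subst affine_baire.simps) simp

lemma affine_baire_pos:
  fixes f :: "'a::{topological_space, real_vector} \<Rightarrow> 'b::topological_real_vector"
  assumes "\<alpha> \<noteq> 0"
  shows "f \<in> affine_baire \<alpha> X \<longleftrightarrow> f \<in> extensional X \<and>
    (\<exists>g. (\<forall>n::nat. \<exists>\<beta><\<alpha>. g n \<in> affine_baire \<beta> X) \<and> (\<forall>x\<in>X. (\<lambda>n. g n x) \<longlonglongrightarrow> f x))"
  using assms by (subst affine_baire.simps) (auto simp: Bex_def)

text \<open>As limits in a non-Hausdorff space are only unique up to \<open>closure {0}\<close>, Baire maps of positive
  class are only affine up to \<open>closure {0}\<close>.\<close>

lemma affine_baire_defect:
  fixes f :: "'a::{topological_space, real_vector} \<Rightarrow> 'b::topological_real_vector"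
  assumes "f \<in> affine_baire \<alpha> X" "convex X" "x \<in> X" "y \<in> X" "0 \<le> t" "t \<le> 1"
  shows "affine_defect f x y t \<in> closure {0}"
  using assms(1)
proof (induction \<alpha> arbitrary: f rule: less_induct)
  case (less \<alpha>)
  show ?case
  proof (cases "\<alpha> = 0")
    case True
    then have "affine_on X f" using less.prems by (simp add: affine_baire_0 cont_affine_def)
    then have "affine_defect f x y t = 0"
      using assms(3-6) by (simp add: affine_defect_def affine_onD)
    then show ?thesis using closure_subset[of "{0}"] by auto
  next
    case False
    then obtain g :: "nat \<Rightarrow> 'a \<Rightarrow> 'b" where
      g: "\<And>n. \<exists>\<beta><\<alpha>. g n \<in> affine_baire \<beta> X" "\<And>x. x \<in> X \<Longrightarrow> (\<lambda>n. g n x) \<longlonglongrightarrow> f x"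
      using less.prems by (auto simp: affine_baire_pos)
    have "\<forall>n. affine_defect (g n) x y t \<in> closure {0}" using g(1) less.IH by blast
    \<comment> \<open>The defect involves the values at three points only, so it follows pointwise
      limits.\<close>
    moreover have "(\<lambda>n. affine_defect (g n) x y t) \<longlonglongrightarrow> affine_defect f x y t"
      unfolding affine_defect_def
      by (intro tendsto_diff tendsto_add tendsto_scaleR_topological tendsto_const g(2)
          convexD_weight assms)
    ultimately show ?thesis
      by (intro Lim_in_closed_set[OF closed_closure]) auto
  qed
qed

section \<open>Lifting maps along a field of functionals\<close>

text \<open>\<open>p y\<close> encodes the functional at \<open>y\<close>. The assumption
  \<open>lift_real\<close> is what ties the functionals at different points together: they depend
  continuously and affinely on \<open>y\<close> when tested on real affine functions.\<close>

locale functional_field =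
  fixes X :: "'a::hausdorff_locally_convex set"
    and Y :: "'b::hausdorff_locally_convex set"
    and K :: real
    and p :: "'b \<Rightarrow> real \<times> 'a \<times> real \<times> 'a"
  assumes compact_X: "compact X" and convex_X: "convex X"
    and compact_Y: "compact Y" and convex_Y: "convex Y"
    and p_in: "y \<in> Y \<Longrightarrow> p y \<in> ev_box K X"
    and lift_real: "g \<in> cont_affine X \<Longrightarrow> (\<lambda>y\<in>Y. ev g (p y) :: real) \<in> cont_affine Y"
begin

definition lift :: "('a \<Rightarrow> 'c::topological_real_vector) \<Rightarrow> 'b \<Rightarrow> 'c" where
  "lift f = (\<lambda>y\<in>Y. ev f (p y))"

text \<open>The parameters \<open>p\<close> need not depend continuously on \<open>y\<close>, but all parameters representing the
  functional at \<open>y\<close> form a closed relation with compact range, and \<open>ev f\<close> only depends on the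
  functional.\<close>

lemma continuous_on_lift:
  fixes f :: "'a \<Rightarrow> 'c::topological_real_vector"
  assumes f: "f \<in> cont_affine X"
  shows "continuous_on Y (\<lambda>y. ev f (p y))"
proof -
  let ?C = "Y \<times> ev_box K X"
  let ?E = "\<lambda>g. ?C \<inter> (\<lambda>w. ev g (snd w) - ev g (p (fst w)) :: real) -` {0}"
  \<comment> \<open>\<open>W\<close> relates \<open>y\<close> to every parameter that represents the
    functional at \<open>y\<close>. It is closed because \<open>ev g (p y)\<close> is continuous in
    \<open>y\<close> by \<open>lift_real\<close>.\<close>
  define W where "W = ?C \<inter> (\<Inter>g\<in>cont_affine X. ?E g)"
  have C: "compact ?C" by (intro compact_Times compact_Y compact_ev_box compact_X)
  then have closed_C: "closed ?C" by (rule compact_imp_closed)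
  have snd_C: "continuous_on ?C (\<lambda>w. ev h (snd w))" if "continuous_on X h"
    for h :: "'a \<Rightarrow> 'd::topological_real_vector"
    by (rule continuous_on_compose2[OF continuous_on_ev[OF that, of K]])
      (auto intro: continuous_intros)
  have "closed (?E g)" if g: "g \<in> cont_affine X" for g
  proof (intro continuous_closed_preimage closed_C continuous_on_diff snd_C)
    show "continuous_on X g" by (rule cont_affineD(2)[OF g])
    have "continuous_on Y (\<lambda>y. ev g (p y))"
      using cont_affineD(2)[OF lift_real[OF g]] by (simp cong: continuous_on_cong)
    then show "continuous_on ?C (\<lambda>w. ev g (p (fst w)))"
      by (rule continuous_on_compose2) (auto intro: continuous_intros)
  qed simp
  then have "compact W"
    unfolding W_def by (intro compact_Int_closed C closed_INT) blast
  then have closed_W: "closed W" by (rule compact_imp_closed)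
  have W: "(y, q) \<in> W \<longleftrightarrow> y \<in> Y \<and> q \<in> ev_box K X \<and> (\<forall>g\<in>cont_affine X. ev g q = (ev g (p y) :: real))"
    for y q
    by (auto simp: W_def)
  have "closed ((\<lambda>y. ev f (p y)) -` B \<inter> Y)" if B: "closed B" for B
  proof -
    have "W \<subseteq> ?C" by (auto simp: W_def)
    then have "continuous_on W (\<lambda>w. ev f (snd w))"
      by (rule continuous_on_subset[OF snd_C[OF cont_affineD(2)[OF f]]])
    then have "closed (W \<inter> (\<lambda>w. ev f (snd w)) -` B)"
      by (intro continuous_closed_preimage closed_W B)
    then have "compact (W \<inter> (W \<inter> (\<lambda>w. ev f (snd w)) -` B))"
      by (intro compact_Int_closed \<open>compact W\<close>)
    then have "compact (fst ` (W \<inter> (W \<inter> (\<lambda>w. ev f (snd w)) -` B)))"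
      by (intro compact_continuous_image continuous_intros)
    \<comment> \<open>The preimage of \<open>B\<close> is thus a projection of a compact set. By
      \<open>ev_unique\<close>, whether \<open>ev f q\<close> lies in \<open>B\<close> is the same
      for all parameters \<open>q\<close> related to \<open>y\<close>.\<close>
    moreover have "fst ` (W \<inter> (W \<inter> (\<lambda>w. ev f (snd w)) -` B)) = (\<lambda>y. ev f (p y)) -` B \<inter> Y"
    proof (intro equalityI subsetI)
      fix y assume "y \<in> fst ` (W \<inter> (W \<inter> (\<lambda>w. ev f (snd w)) -` B))"
      then obtain q where q: "(y, q) \<in> W" "ev f q \<in> B" by auto
      have "ev f q = ev f (p y)"
        using q(1) p_in by (intro ev_unique[OF convex_X cont_affineD(3)[OF f], of _ K]) (auto simp: W)
      then show "y \<in> (\<lambda>y. ev f (p y)) -` B \<inter> Y" using q W by simp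
    next
      fix y assume "y \<in> (\<lambda>y. ev f (p y)) -` B \<inter> Y"
      then have "(y, p y) \<in> W \<inter> (W \<inter> (\<lambda>w. ev f (snd w)) -` B)" using p_in by (simp add: W)
      then show "y \<in> fst ` (W \<inter> (W \<inter> (\<lambda>w. ev f (snd w)) -` B))" by force
    qed
    ultimately show ?thesis by (metis compact_imp_closed)
  qed
  then show ?thesis
    using continuous_on_closed_vimage[OF compact_imp_closed[OF compact_Y]] by blast
qed

text \<open>The parameter at the convex combination and the mixture of the two parameters agree on
  real affine functions by \<open>lift_real\<close>, hence on \<open>f\<close> by
  \<open>ev_unique\<close>.\<close>

lemma affine_on_lift:
  fixes f :: "'a \<Rightarrow> 'c::topological_real_vector"
  assumes f: "f \<in> cont_affine X"
  shows "affine_on Y (\<lambda>y. ev f (p y))"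
  unfolding affine_on_def
proof (intro ballI)
  fix x y and t :: real assume xy: "x \<in> Y" "y \<in> Y" and "t \<in> {0..1}"
  then have t: "0 \<le> t" "t \<le> 1" by auto
  let ?z = "(1 - t) *\<^sub>R x + t *\<^sub>R y"
  have z: "?z \<in> Y" using convex_Y xy t by (rule convexD_weight)
  have "ev f (p ?z) = ev f (ev_mix t (p x) (p y))"
  proof (rule ev_unique[OF convex_X cont_affineD(3)[OF f]])
    fix g :: "'a \<Rightarrow> real" assume g: "g \<in> cont_affine X"
    have "ev g (p ?z) = (1 - t) *\<^sub>R ev g (p x) + t *\<^sub>R ev g (p y)"
      using affine_onD[OF cont_affineD(3)[OF lift_real[OF g]] xy t] xy z by simp
    then show "ev g (p ?z) = ev g (ev_mix t (p x) (p y))"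
      using ev_mix[OF cont_affineD(3)[OF g] p_in p_in t] xy by simp
  qed (use xy z t p_in convex_X in \<open>auto intro: ev_mix_in\<close>)
  then show "ev f (p ?z) = (1 - t) *\<^sub>R ev f (p x) + t *\<^sub>R ev f (p y)"
    using ev_mix[OF cont_affineD(3)[OF f] p_in p_in t] xy by simp
qed

lemma lift_cont_affine: "f \<in> cont_affine X \<Longrightarrow> lift f \<in> cont_affine Y"
  unfolding lift_def
  by (intro restrict_cont_affine continuous_on_lift affine_on_lift convex_Y)

text \<open>At each \<open>y\<close> the lift is a fixed linear combination of two values of the
  map.\<close>

lemma tendsto_lift:
  assumes "\<And>x. x \<in> X \<Longrightarrow> (\<lambda>n. g n x) \<longlonglongrightarrow> f x" "y \<in> Y"
  shows "(\<lambda>n. lift (g n) y) \<longlonglongrightarrow> lift f y"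
  using tendsto_ev[OF assms(1) p_in] assms(2) by (simp add: lift_def)

lemma lift_affine_baire:
  fixes f :: "'a \<Rightarrow> 'c::topological_real_vector"
  assumes "f \<in> affine_baire \<alpha> X"
  shows "lift f \<in> affine_baire \<alpha> Y"
  using assms
proof (induction \<alpha> arbitrary: f rule: less_induct)
  case (less \<alpha>)
  show ?case
  proof (cases "\<alpha> = 0")
    case True
    then show ?thesis using less.prems by (simp add: affine_baire_0 lift_cont_affine)
  next
    case False
    then obtain g :: "nat \<Rightarrow> 'a \<Rightarrow> 'c" where
      g: "\<And>n. \<exists>\<beta><\<alpha>. g n \<in> affine_baire \<beta> X" "\<And>x. x \<in> X \<Longrightarrow> (\<lambda>n. g n x) \<longlonglongrightarrow> f x"
      using less.prems by (auto simp: affine_baire_pos)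
    have "\<exists>\<beta><\<alpha>. lift (g n) \<in> affine_baire \<beta> Y" for n
      using g(1) less.IH by blast
    moreover have "lift f \<in> extensional Y" by (simp add: lift_def)
    ultimately show ?thesis
      unfolding affine_baire_pos[OF False] using tendsto_lift[OF g(2)]
      by (intro conjI exI[of _ "\<lambda>n. lift (g n)"]) auto
  qed
qed

end

text \<open>The functional at \<open>y\<close> is \<open>g \<mapsto> P g x\<close> for any \<open>x\<close> above \<open>y\<close>.\<close>

lemma complemented_functional_field:
  fixes X :: "'a::hausdorff_locally_convex set" and Y :: "'b::hausdorff_locally_convex set"
  assumes X: "compact X" "convex X" and Y: "compact Y" "convex Y" and \<phi>: "\<phi> ` X = Y"
    and compl: "complemented_in X (cont_affine X) (pullback X \<phi> ` cont_affine Y)"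
  obtains K p where "functional_field X Y K p"
    and "\<And>h y. h \<in> cont_affine Y \<Longrightarrow> y \<in> Y \<Longrightarrow> ev (compose X h \<phi>) (p y) = (h y :: real)"
proof -
  let ?V = "cont_affine X :: ('a \<Rightarrow> real) set"
  obtain P where P: "bounded_linear_projection X ?V P"
    and range: "P ` ?V = pullback X \<phi> ` cont_affine Y"
    using compl by (auto simp: complemented_in_def)
  obtain K where K: "\<And>g. g \<in> ?V \<Longrightarrow> sup_norm X (P g) \<le> K * sup_norm X g"
    using P unfolding bounded_linear_projection_def by blast
  have PV: "P g \<in> ?V" if "g \<in> ?V" for g
    using P that by (auto simp: bounded_linear_projection_def)
  have PP: "P (P g) = P g" if "g \<in> ?V" for g
    using P that by (auto simp: bounded_linear_projection_def)
  have factor: "\<exists>k\<in>cont_affine Y. P g = compose X k \<phi>" if "g \<in> ?V" for g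
    using imageI[OF that, of P] unfolding range by (auto simp: pullback_def)
  have P_add: "P (\<lambda>x\<in>X. g x + h x) = (\<lambda>x\<in>X. P g x + P h x)" if "g \<in> ?V" "h \<in> ?V" for g h
    using P that by (auto simp: bounded_linear_projection_def)
  have P_scale: "P (\<lambda>x\<in>X. c * g x) = (\<lambda>x\<in>X. c * P g x)" if "g \<in> ?V" for c g
    using P that by (auto simp: bounded_linear_projection_def)
  \<comment> \<open>The definition of the projection puts no sign on \<open>K\<close>;
    \<open>max K 0\<close> supplies a nonnegative bound.\<close>
  have "\<exists>q\<in>ev_box (max K 0) X. \<forall>g\<in>?V. \<forall>x\<in>X. \<phi> x = y \<longrightarrow> ev g q = P g x" if "y \<in> Y" for y
  proof -
    obtain x where x: "x \<in> X" "\<phi> x = y" using \<phi> \<open>y \<in> Y\<close> by blast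
    \<comment> \<open>\<open>P g\<close> factors through \<open>\<phi>\<close>, so its value does
      not depend on the point chosen above \<open>y\<close>.\<close>
    have fibre: "P g x' = P g x" if g: "g \<in> ?V" and x': "x' \<in> X" "\<phi> x' = y" for g x'
    proof -
      obtain k where "P g = compose X k \<phi>" using factor[OF g] by blast
      then show ?thesis using x x' by (simp add: compose_def)
    qed
    have "\<exists>q\<in>ev_box (max K 0) X. \<forall>g\<in>?V. ev g q = P g x"
    proof (rule bounded_functional_representation[OF X])
      show "\<bar>P g x\<bar> \<le> max K 0 * sup_norm X g" if g: "g \<in> ?V" for g
      proof -
        have "\<bar>P g x\<bar> \<le> sup_norm X (P g)"
          by (rule le_sup_norm[OF X(1) cont_affineD(2)[OF PV[OF g]] x(1)])
        also have "\<dots> \<le> K * sup_norm X g" by (rule K[OF g])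
        also have "\<dots> \<le> max K 0 * sup_norm X g"
          using le_sup_norm[OF X(1) cont_affineD(2)[OF g] x(1)] by (intro mult_right_mono) auto
        finally show ?thesis .
      qed
    qed (use x in \<open>auto simp: P_add P_scale\<close>)
    then show ?thesis using fibre by metis
  qed
  then obtain p where p_in: "\<And>y. y \<in> Y \<Longrightarrow> p y \<in> ev_box (max K 0) X"
    and p: "\<And>g x. g \<in> ?V \<Longrightarrow> x \<in> X \<Longrightarrow> ev g (p (\<phi> x)) = P g x"
    using \<phi> by (metis imageI)
  have "functional_field X Y (max K 0) p"
  proof
    fix g assume g: "g \<in> ?V"
    then obtain k where k: "k \<in> cont_affine Y" "P g = compose X k \<phi>"
      using factor by blast
    have "ev g (p y) = k y" if "y \<in> Y" for y
      using p[OF g] k(2) \<phi> that by (auto simp: compose_def)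
    then have "(\<lambda>y\<in>Y. ev g (p y)) = k"
      using cont_affineD(1)[OF k(1)] by (auto simp: extensional_def)
    then show "(\<lambda>y\<in>Y. ev g (p y)) \<in> cont_affine Y" using k(1) by simp
  qed (use X Y p_in in auto)
  moreover have "ev (compose X h \<phi>) (p y) = h y" if h: "h \<in> cont_affine Y" "y \<in> Y"
    for h :: "'b \<Rightarrow> real" and y
  proof -
    \<comment> \<open>Elements of the range of \<open>P\<close> are fixed by
      \<open>P\<close>.\<close>
    have "compose X h \<phi> \<in> P ` ?V" using range h(1) by (auto simp: pullback_def)
    then obtain g where g: "g \<in> ?V" "compose X h \<phi> = P g" by blast
    obtain x where x: "x \<in> X" "\<phi> x = y" using \<phi> h(2) by blast
    show ?thesis using p[OF PV[OF g(1)] x(1)] PP[OF g(1)] x g(2)[symmetric]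
      by (simp add: compose_def)
  qed
  ultimately show thesis by (rule that)
qed

text \<open>On real affine functions the parameter acts as evaluation at \<open>y\<close>, so
  \<open>\<phi> x\<close> is the barycentre of mass \<open>1\<close> at \<open>y\<close> and mass
  \<open>b\<close> at \<open>\<phi> z\<close>. If \<open>f\<close> composed with
  \<open>\<phi>\<close> were affine, this would give exactly \<open>f y\<close>; the defect measures
  the error.\<close>

lemma ev_compose_defect:
  fixes X :: "'a::hausdorff_locally_convex set" and Y :: "'b::hausdorff_locally_convex set"
    and f :: "'b \<Rightarrow> 'c::real_vector"
  assumes X: "convex X" and Y: "convex Y" and \<phi>: "affine_on X \<phi>" "\<phi> ` X = Y"
    and y: "y \<in> Y" and q: "q \<in> ev_box K X"
    and repr: "\<And>h. h \<in> cont_affine Y \<Longrightarrow> ev (compose X h \<phi>) q = (h y :: real)"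
  obtains c u v t where "u \<in> X" "v \<in> X" "0 \<le> t" "t \<le> 1"
    and "ev (compose X f \<phi>) q = f y + c *\<^sub>R affine_defect (compose X f \<phi>) u v t"
proof -
  obtain a x b z where q_eq: "q = (a, x, b, z)" by (cases q) auto
  have xz: "x \<in> X" "z \<in> X" and pos: "a \<ge> 0" "b \<ge> 0"
    using q by (auto simp: q_eq ev_box_def)
  have in_Y: "\<phi> x \<in> Y" "\<phi> z \<in> Y" using xz \<phi>(2) by auto
  have a: "a = 1 + b"
    using repr[OF cont_affine_const[OF Y, of 1]] xz in_Y y
    by (simp add: q_eq ev_def compose_def)
  obtain u where u: "u \<in> X" "\<phi> u = y" using y \<phi>(2) by blast
  define t where "t = b / a"
  have t: "0 \<le> t" "t \<le> 1" "a * t = b" "a * (1 - t) = 1"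
    using a pos by (auto simp: t_def field_simps)
  define w where "w = (1 - t) *\<^sub>R u + t *\<^sub>R z"
  have w: "w \<in> X" unfolding w_def using X u(1) xz(2) t(1,2) by (rule convexD_weight)
  have \<phi>w: "\<phi> w = (1 - t) *\<^sub>R y + t *\<^sub>R \<phi> z"
    unfolding w_def using affine_onD[OF \<phi>(1) u(1) xz(2) t(1,2)] u(2) by simp
  \<comment> \<open>\<open>x\<close> and \<open>w\<close> may differ, but \<open>f\<close> composed
    with \<open>\<phi>\<close> takes the same value at both, and \<open>w\<close> is an explicit
    convex combination in \<open>X\<close>.\<close>
  have "\<phi> x = \<phi> w"
  proof (rule cont_affine_separation[OF Y])
    fix h :: "'b \<Rightarrow> real" assume h: "h \<in> cont_affine Y"
    have "a * h (\<phi> w) = (a * (1 - t)) * h y + (a * t) * h (\<phi> z)"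
      using affine_onD[OF cont_affineD(3)[OF h] y in_Y(2) t(1,2)]
      by (simp only: \<phi>w real_scaleR_def distrib_left mult.assoc)
    also have "\<dots> = a * h (\<phi> x)"
      unfolding t(3,4) using repr[OF h] xz by (simp add: q_eq ev_def compose_def)
    finally show "h (\<phi> x) = h (\<phi> w)" using a pos by simp
  qed (use in_Y w \<phi>(2) in auto)
  then have "ev (compose X f \<phi>) q = a *\<^sub>R f (\<phi> w) - (a * t) *\<^sub>R f (\<phi> z)"
    using xz t(3) by (simp add: q_eq ev_def compose_def)
  also have "\<dots> = (a * (1 - t)) *\<^sub>R f y + a *\<^sub>R affine_defect (compose X f \<phi>) u z t"
    using u xz w by (simp add: affine_defect_def compose_def w_def[symmetric] scaleR_diff_right
        scaleR_add_right)
  finally show thesis using t u(1) xz(2) by (intro that[of u z t a]) auto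
qed

theorem theorem1p1:
  fixes X :: "'a::hausdorff_locally_convex set"
    and Y :: "'b::hausdorff_locally_convex set"
    and \<phi> :: "'a \<Rightarrow> 'b"
    and f :: "'b \<Rightarrow> 'c::topological_real_vector"
    and \<alpha> :: omega1
  assumes "compact X" and "convex X"
    and "compact Y" and "convex Y"
    and "continuous_on X \<phi>" and "affine_on X \<phi>" and "\<phi> ` X = Y"
    and "complemented_in X (cont_affine X) (pullback X \<phi> ` cont_affine Y)"
    and "f \<in> extensional Y"
    and "compose X f \<phi> \<in> affine_baire \<alpha> X"
  shows "f \<in> affine_baire \<alpha> Y"
proof -
  let ?h = "compose X f \<phi>"
  obtain K p where field: "functional_field X Y K p"
    and repr: "\<And>h y. h \<in> cont_affine Y \<Longrightarrow> y \<in> Y \<Longrightarrow> ev (compose X h \<phi>) (p y) = (h y :: real)"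
    using complemented_functional_field[OF assms(1-4,7,8)] by blast
  interpret functional_field X Y K p by (rule field)
  have defect: "\<exists>c u v t. u \<in> X \<and> v \<in> X \<and> 0 \<le> t \<and> t \<le> 1 \<and>
      lift ?h y = f y + c *\<^sub>R affine_defect ?h u v t" if y: "y \<in> Y" for y
  proof -
    obtain c u v t where "u \<in> X" "v \<in> X" "0 \<le> t" "t \<le> 1"
      "ev ?h (p y) = f y + c *\<^sub>R affine_defect ?h u v t"
      by (rule ev_compose_defect[OF assms(2,4,6,7) y p_in[OF y], of f]) (use repr y in auto)
    then show ?thesis using y by (auto simp: lift_def)
  qed
  show ?thesis
  proof (cases "\<alpha> = 0")
    case True
    then have h: "?h \<in> cont_affine X" using assms(10) by (simp add: affine_baire_0)
    \<comment> \<open>In class \<open>0\<close> the map is exactly affine, so the defect vanishes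
      and the lift is \<open>f\<close> itself.\<close>
    have "lift ?h y = f y" if "y \<in> Y" for y
      using defect[OF that] affine_onD[OF cont_affineD(3)[OF h]]
      by (auto simp: affine_defect_def)
    then have "lift ?h = f"
      using assms(9) by (intro extensionalityI[of _ Y]) (auto simp: lift_def)
    then show ?thesis using lift_affine_baire[OF assms(10)] by simp
  next
    case False
    then obtain g :: "nat \<Rightarrow> 'a \<Rightarrow> 'c" where
      g: "\<And>n. \<exists>\<beta><\<alpha>. g n \<in> affine_baire \<beta> X" "\<And>x. x \<in> X \<Longrightarrow> (\<lambda>n. g n x) \<longlonglongrightarrow> ?h x"
      using assms(10) by (auto simp: affine_baire_pos)
    \<comment> \<open>In positive classes \<open>lift ?h\<close> may differ from \<open>f\<close>,
      but the lifted sequence still converges to \<open>f\<close>: the difference is a multiple of a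
      defect to which the constant sequence \<open>0\<close> converges.\<close>
    have "(\<lambda>n. lift (g n) y) \<longlonglongrightarrow> f y" if y: "y \<in> Y" for y
    proof -
      obtain c u v t where uv: "u \<in> X" "v \<in> X" "0 \<le> t" "t \<le> 1"
        and eq: "lift ?h y = f y + c *\<^sub>R affine_defect ?h u v t"
        using defect[OF y] by blast
      have "(\<lambda>n. 0) \<longlonglongrightarrow> affine_defect ?h u v t"
        using affine_baire_defect[OF assms(10,2) uv] by (rule tendsto_closure_0)
      then have "(\<lambda>n. lift (g n) y - c *\<^sub>R 0) \<longlonglongrightarrow> lift ?h y - c *\<^sub>R affine_defect ?h u v t"
        by (intro tendsto_diff tendsto_lift[OF g(2) y] tendsto_scaleR_topological tendsto_const)
      then show ?thesis by (simp add: eq)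
    qed
    moreover have "\<exists>\<beta><\<alpha>. lift (g n) \<in> affine_baire \<beta> Y" for n
      using g(1) lift_affine_baire by blast
    ultimately show ?thesis
      unfolding affine_baire_pos[OF False] using assms(9)
      by (intro conjI exI[of _ "\<lambda>n. lift (g n)"]) auto
  qed
qed

end
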